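(* Let $\mathfrak{H}=(W,\lambda)$ be an absolutely homogeneous GEC. For a GEC $\mathfrak{G}=(V,\kappa)$ the following conditions are equivalent: (i) there exists a morphism from $\mathfrak{G}$ into $\mathfrak{H}$; (ii) for every finite non-empty sub-GEC $\mathfrak{F}$ of $\mathfrak{G}$ there exists a morphism from $\mathfrak{F}$ into $\mathfrak{H}$.
   Context: A GEC (full graph with edge-coloring) is a pair $\mathfrak{G}=(V,\kappa)$ where $V$ is a (possibly empty, possibly infinite) set of vertices and $\kappa\colon V\times V\to Y$ is a surjection onto some set $Y$ such that for all $x,y,z\in V$: (GEC1) $\kappa(x,y)=\kappa(z,z)\iff x=y$; (GEC2) $\kappa(y,x)=\kappa(x,y)$. A sub-GEC of $(V,\kappa)$ is a GEC of the form $(A,\kappa\restriction_{A\times A})$ with $A\subset V$. For GECs $(V,\kappa)$ and $(W,\lambda)$, a partial morphism from $(V,\kappa)$ into $(W,\lambda)$ is a function $f\colon A\to W$ with $A\subset V$ such that $\kappa(a,b)=\lambda(f(a),f(b))$ for all $a,b\in A$ (so $f$ is automatically injective). It is a morphism if $A=V$, and an isomorphism if moreover it is bijective; an automorphism is an isomorphism of a GEC onto itself. A GEC is absolutely homogeneous if every partial morphism from it into itself extends to an automorphism. *)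

theory Defs
  imports Main "HOL-Library.FuncSet"
begin

(* Only the values of the colouring on verts x verts matter; the set Y of colours, onto which the
   colouring is a surjection, is the image of verts x verts under the colouring and is therefore
   not a separate component. The colours of GECs that are compared by morphisms are drawn from
   one type 'c, but their colour sets Y may be different. *)
record ('v, 'c) gec =
  verts :: "'v set"
  col :: "'v \<times> 'v \<Rightarrow> 'c"

definition is_gec :: "('v, 'c) gec \<Rightarrow> bool" where
  "is_gec G \<longleftrightarrow>
    (\<forall>x\<in>verts G. \<forall>y\<in>verts G. \<forall>z\<in>verts G. col G (x, y) = col G (z, z) \<longleftrightarrow> x = y) \<and>
    (\<forall>x\<in>verts G. \<forall>y\<in>verts G. col G (y, x) = col G (x, y))"

definition sub_gec :: "('v, 'c) gec \<Rightarrow> ('v, 'c) gec \<Rightarrow> bool" where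
  "sub_gec F G \<longleftrightarrow> is_gec F \<and>
    (\<exists>A. A \<subseteq> verts G \<and> F = \<lparr>verts = A, col = restrict (col G) (A \<times> A)\<rparr>)"

(* The domain A is an explicit argument; the values of f outside A are irrelevant. *)
definition partial_morphism ::
    "'v set \<Rightarrow> ('v \<Rightarrow> 'w) \<Rightarrow> ('v, 'c) gec \<Rightarrow> ('w, 'c) gec \<Rightarrow> bool" where
  "partial_morphism A f G H \<longleftrightarrow> A \<subseteq> verts G \<and> f \<in> A \<rightarrow> verts H \<and>
    (\<forall>a\<in>A. \<forall>b\<in>A. col G (a, b) = col H (f a, f b))"

definition morphism :: "('v \<Rightarrow> 'w) \<Rightarrow> ('v, 'c) gec \<Rightarrow> ('w, 'c) gec \<Rightarrow> bool" where
  "morphism f G H \<longleftrightarrow> partial_morphism (verts G) f G H"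

definition isomorphism :: "('v \<Rightarrow> 'w) \<Rightarrow> ('v, 'c) gec \<Rightarrow> ('w, 'c) gec \<Rightarrow> bool" where
  "isomorphism f G H \<longleftrightarrow> morphism f G H \<and> bij_betw f (verts G) (verts H)"

definition automorphism :: "('v \<Rightarrow> 'v) \<Rightarrow> ('v, 'c) gec \<Rightarrow> bool" where
  "automorphism f G \<longleftrightarrow> isomorphism f G G"

definition absolutely_homogeneous :: "('v, 'c) gec \<Rightarrow> bool" where
  "absolutely_homogeneous G \<longleftrightarrow>
    (\<forall>A f. partial_morphism A f G G \<longrightarrow> (\<exists>u. automorphism u G \<and> (\<forall>a\<in>A. u a = f a)))"

end

theory Submission
  imports Defs
begin

text \<open>
  A structure all of whose finite parts embed need not embed itself (a long chain of local
  embeddings may be incoherent); absolute homogeneity of the target is what restores coherence.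
  If \<open>g\<close> embeds \<open>A\<close> and \<open>f\<close> embeds a larger set \<open>B\<close>, then \<open>g \<circ> f\<inverse>\<close> is a partial morphism of the
  target into itself, and composing \<open>f\<close> with an automorphism that extends it yields an embedding
  of \<open>B\<close> that agrees with \<open>g\<close> on \<open>A\<close> (\<open>partial_morphism_extend\<close>).  So an embedding of \<open>A\<close> extends
  to \<open>B\<close> as soon as \<open>B\<close> has any embedding at all.

  Consequently embeddings can be glued along a well-order: if each closed initial segment embeds,
  then so does the whole set (\<open>partial_morphism_along_well_order\<close>).  Choosing the well-order of an
  infinite set to be its cardinal makes every closed initial segment strictly smaller in
  cardinality, so induction on cardinality reduces the embeddability of arbitrary sets to that of
  finite ones (\<open>partial_morphism_from_finite\<close>).  The full strength of homogeneity is used: the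
  partial morphisms that have to be extended to automorphisms may have infinite domains.
\<close>

section \<open>Extending partial morphisms\<close>

lemma partial_morphism_inj_on:
  assumes "is_gec G" "is_gec H" "partial_morphism A f G H"
  shows "inj_on f A"
proof (rule inj_onI)
  fix a b
  assume ab: "a \<in> A" "b \<in> A" "f a = f b"
  then have "col G (a, b) = col G (b, b)"
    using assms(3) by (simp add: partial_morphism_def)
  then show "a = b"
    using assms(1,3) ab(1,2) unfolding is_gec_def partial_morphism_def by blast
qed

lemma partial_morphism_subset:
  assumes "partial_morphism B f G H" "A \<subseteq> B"
  shows "partial_morphism A f G H"
  using assms unfolding partial_morphism_def by blast

text \<open>
  The embedding \<open>f\<close> of \<open>B\<close> moves \<open>A\<close> to some copy inside the target; an automorphism of the
  target carries that copy onto the prescribed one.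
\<close>

lemma partial_morphism_extend:
  assumes G: "is_gec G" and H: "is_gec H" and hom: "absolutely_homogeneous H"
    and g: "partial_morphism A g G H" and f: "partial_morphism B f G H" and AB: "A \<subseteq> B"
  obtains h where "partial_morphism B h G H" "\<And>a. a \<in> A \<Longrightarrow> h a = g a"
proof -
  have inv: "inv_into A f (f a) = a" if "a \<in> A" for a
    using that partial_morphism_inj_on[OF G H partial_morphism_subset[OF f AB]]
    by (simp add: inv_into_f_f)
  have "partial_morphism (f ` A) (g \<circ> inv_into A f) H H"
    unfolding partial_morphism_def
  proof (intro conjI ballI)
    show "f ` A \<subseteq> verts H"
      using f AB unfolding partial_morphism_def by blast
    show "g \<circ> inv_into A f \<in> f ` A \<rightarrow> verts H"
      using g inv by (auto simp: partial_morphism_def)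
    fix x y
    assume "x \<in> f ` A" "y \<in> f ` A"
    then obtain a b where ab: "a \<in> A" "b \<in> A" and xy: "x = f a" "y = f b"
      by blast
    have "col H (f a, f b) = col G (a, b)"
      using f AB ab unfolding partial_morphism_def by (metis subsetD)
    also have "\<dots> = col H (g a, g b)"
      using g ab unfolding partial_morphism_def by blast
    finally show "col H (x, y) = col H ((g \<circ> inv_into A f) x, (g \<circ> inv_into A f) y)"
      using ab by (simp add: xy inv)
  qed
  then obtain u where u: "automorphism u H"
    and u_ext: "\<forall>y\<in>f ` A. u y = (g \<circ> inv_into A f) y"
    using hom unfolding absolutely_homogeneous_def by meson
  have "partial_morphism B (u \<circ> f) G H"
    using f u
    by (auto simp: partial_morphism_def automorphism_def isomorphism_def morphism_def Pi_iff)
  moreover have "(u \<circ> f) a = g a" if "a \<in> A" for a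
    using u_ext inv that by simp
  ultimately show thesis
    by (rule that)
qed

section \<open>Gluing along a well-order\<close>

text \<open>
  Zorn's lemma is applied to the graphs of embeddings whose domains are initial segments.
  Representing them as relations makes unions of chains immediate, since preservation of colours
  is a condition on pairs of points; and a colour-preserving relation is automatically
  single-valued.  If the domain of a maximal graph missed some point, then it would consist of
  exactly the points below the least missing point \<open>v\<close>; since the closed segment up to \<open>v\<close> embeds,
  the graph would extend to \<open>v\<close>, against maximality.
\<close>

lemma partial_morphism_along_well_order:
  assumes G: "is_gec G" and H: "is_gec H" and hom: "absolutely_homogeneous H"
    and A: "A \<subseteq> verts G" and wo: "well_order_on A r"
    and seg: "\<And>v. v \<in> A \<Longrightarrow> \<exists>f. partial_morphism (under r v) f G H"
  shows "\<exists>f. partial_morphism A f G H"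
proof -
  define P where "P = {R. R \<subseteq> A \<times> verts H \<and>
    (\<forall>(a, x)\<in>R. \<forall>(b, y)\<in>R. col G (a, b) = col H (x, y)) \<and>
    (\<forall>a\<in>Domain R. under r a \<subseteq> Domain R)}"
  have P_sub: "T \<subseteq> A \<times> verts H"
    and P_col: "\<And>a x b y. (a, x) \<in> T \<Longrightarrow> (b, y) \<in> T \<Longrightarrow> col G (a, b) = col H (x, y)"
    and P_down: "\<And>a. a \<in> Domain T \<Longrightarrow> under r a \<subseteq> Domain T"
    if "T \<in> P" for T
    using that by (simp_all add: P_def) fast+
  have "\<Union>C \<in> P" if "C \<in> chains P" for C
  proof -
    have CP: "C \<subseteq> P" and chain: "\<And>R S. R \<in> C \<Longrightarrow> S \<in> C \<Longrightarrow> R \<subseteq> S \<or> S \<subseteq> R"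
      using that by (auto simp: chains_def chain_subset_def)
    have "col G (a, b) = col H (x, y)" if "(a, x) \<in> \<Union>C" "(b, y) \<in> \<Union>C" for a b x y
    proof -
      obtain T where "T \<in> C" "(a, x) \<in> T" "(b, y) \<in> T"
        using \<open>(a, x) \<in> \<Union>C\<close> \<open>(b, y) \<in> \<Union>C\<close> chain by blast
      then show ?thesis
        using CP P_col by blast
    qed
    moreover have "under r a \<subseteq> Domain (\<Union>C)" if "a \<in> Domain (\<Union>C)" for a
    proof -
      obtain T where T: "T \<in> C" "a \<in> Domain T"
        using \<open>a \<in> Domain (\<Union>C)\<close> by blast
      then have "under r a \<subseteq> Domain T"
        using CP P_down by blast
      then show ?thesis
        using T(1) by blast
    qed
    moreover have "\<Union>C \<subseteq> A \<times> verts H"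
      using CP P_sub by blast
    ultimately show ?thesis
      unfolding P_def by blast
  qed
  then obtain R where "R \<in> P" and maximal: "\<And>S. S \<in> P \<Longrightarrow> R \<subseteq> S \<Longrightarrow> S = R"
    using Zorn_Lemma[of P] by blast
  note RA = P_sub[OF \<open>R \<in> P\<close>] and R_col = P_col[OF \<open>R \<in> P\<close>] and R_down = P_down[OF \<open>R \<in> P\<close>]
  have "\<forall>a\<in>Domain R. \<exists>x. (a, x) \<in> R"
    by blast
  then obtain f where f: "\<And>a. a \<in> Domain R \<Longrightarrow> (a, f a) \<in> R"
    by (metis bchoice)
  have f_unique: "x = f a" if "(a, x) \<in> R" for a x
  proof -
    have "(a, f a) \<in> R"
      using f that by blast
    then have "col H (x, f a) = col H (f a, f a)"
      using R_col that by metis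
    moreover have "x \<in> verts H" "f a \<in> verts H"
      using RA that \<open>(a, f a) \<in> R\<close> by blast+
    ultimately show ?thesis
      using H unfolding is_gec_def by blast
  qed
  have f_pm: "partial_morphism (Domain R) f G H"
    unfolding partial_morphism_def
  proof (intro conjI ballI)
    show "Domain R \<subseteq> verts G"
      using RA A by blast
    show "f \<in> Domain R \<rightarrow> verts H"
      using f RA by blast
    show "col G (a, b) = col H (f a, f b)" if "a \<in> Domain R" "b \<in> Domain R" for a b
      using R_col[OF f f] that by blast
  qed
  have "Domain R = A"
  proof (rule ccontr)
    assume "Domain R \<noteq> A"
    then have "A - Domain R \<noteq> {}"
      using RA by blast
    moreover have "wf (r - Id)"
      using wo by (simp add: well_order_on_def)
    ultimately obtain v where v: "v \<in> A - Domain R"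
      and least: "\<And>b. (b, v) \<in> r - Id \<Longrightarrow> b \<notin> A - Domain R"
      by (metis wfE_min')
    have r: "r \<subseteq> A \<times> A" "refl_on A r" "total_on A r" "trans r"
      using wo
      by (auto simp: well_order_on_def linear_order_on_def partial_order_on_def preorder_on_def)
    have below: "(a, v) \<in> r" if "a \<in> Domain R" for a
    proof -
      have "a \<in> A" "a \<noteq> v" "v \<in> A"
        using that v RA by auto
      moreover have "(v, a) \<notin> r"
        using R_down[OF that] v unfolding under_def by blast
      ultimately show ?thesis
        using r(3) unfolding total_on_def by blast
    qed
    have under_v: "under r v = insert v (Domain R)"
      using below least v r(1,2) unfolding under_def refl_on_def by blast
    obtain g where "partial_morphism (insert v (Domain R)) g G H"
      using seg v under_v by fastforce
    then obtain h where h: "partial_morphism (insert v (Domain R)) h G H"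
      and h_f: "\<And>a. a \<in> Domain R \<Longrightarrow> h a = f a"
      using partial_morphism_extend[OF G H hom f_pm] by blast
    define S where "S = (\<lambda>a. (a, h a)) ` insert v (Domain R)"
    have dom_S: "Domain S = under r v"
      unfolding S_def under_v by force
    have "S \<subseteq> A \<times> verts H" "\<forall>(a, x)\<in>S. \<forall>(b, y)\<in>S. col G (a, b) = col H (x, y)"
      using h v RA unfolding S_def partial_morphism_def by fastforce+
    moreover have "under r a \<subseteq> Domain S" if "a \<in> Domain S" for a
      using that r(4) unfolding dom_S under_def by (blast dest: transD)
    ultimately have "S \<in> P"
      by (auto simp: P_def)
    moreover have "R \<subseteq> S"
    proof (rule subrelI)
      fix a x
      assume "(a, x) \<in> R"
      then have "a \<in> Domain R" "x = h a"
        using f_unique h_f by (blast, metis DomainI)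
      then show "(a, x) \<in> S"
        unfolding S_def by blast
    qed
    ultimately have "S = R"
      by (rule maximal)
    then show False
      using v unfolding S_def by blast
  qed
  then show ?thesis
    using f_pm by blast
qed

section \<open>Induction on cardinality\<close>

text \<open>
  An infinite cardinal is a limit ordinal, so even the \<^emph>\<open>closed\<close> initial segments of a set ordered
  by its cardinal have smaller cardinality, and the induction hypothesis applies to them.
\<close>

lemma partial_morphism_from_finite:
  includes cardinal_syntax
  assumes G: "is_gec G" and H: "is_gec H" and hom: "absolutely_homogeneous H"
    and fin: "\<And>A. A \<subseteq> verts G \<Longrightarrow> finite A \<Longrightarrow> \<exists>f. partial_morphism A f G H"
    and A: "A \<subseteq> verts G"
  shows "\<exists>f. partial_morphism A f G H"
  using A
proof (induction A rule: wf_induct_rule[OF wf_inv_image[OF wf_ordLess, of card_of]])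
  case (1 A)
  show ?case
  proof (cases "finite A")
    case True
    then show ?thesis
      using fin 1 by blast
  next
    case False
    have wo: "well_order_on A |A|"
      by (rule card_of_well_order_on)
    have "\<exists>f. partial_morphism (under |A| v) f G H" if "v \<in> A" for v
    proof -
      obtain w where w: "w \<in> A" "v \<noteq> w" "(v, w) \<in> |A|"
        using infinite_Card_order_limit[OF card_of_Card_order, of A v] False \<open>v \<in> A\<close>
        by (auto simp: Field_card_of)
      have r: "|A| \<subseteq> A \<times> A" "trans |A|" "antisym |A|"
        using wo
        by (auto simp: well_order_on_def linear_order_on_def partial_order_on_def preorder_on_def)
      have "under |A| v \<subseteq> underS |A| w"
        using w r(2,3) unfolding under_def underS_def by (blast dest: transD antisymD)
      moreover have "|underS |A| w| <o |A|"
        using w(1) card_of_underS[OF card_of_Card_order, of w A] by (simp add: Field_card_of)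
      ultimately have "|under |A| v| <o |A|"
        using card_of_mono1 ordLeq_ordLess_trans by blast
      moreover have "under |A| v \<subseteq> verts G"
        using r(1) 1(2) unfolding under_def by blast
      ultimately show ?thesis
        using 1(1) by simp
    qed
    then show ?thesis
      using partial_morphism_along_well_order[OF G H hom 1(2) wo] by blast
  qed
qed

section \<open>Finite sub-GECs\<close>

lemma sub_gec_restrict:
  assumes "is_gec G" "A \<subseteq> verts G"
  shows "sub_gec \<lparr>verts = A, col = restrict (col G) (A \<times> A)\<rparr> G"
proof -
  have "is_gec \<lparr>verts = A, col = restrict (col G) (A \<times> A)\<rparr>"
    using assms unfolding is_gec_def by (simp add: subset_eq)
  then show ?thesis
    using assms(2) unfolding sub_gec_def by blast
qed

lemma morphism_restrict_iff:
  assumes "A \<subseteq> verts G"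
  shows "morphism f \<lparr>verts = A, col = restrict (col G) (A \<times> A)\<rparr> H \<longleftrightarrow> partial_morphism A f G H"
  using assms by (simp add: morphism_def partial_morphism_def)

theorem theorem3p9:
  fixes H :: "('w, 'c) gec" and G :: "('v, 'c) gec"
  assumes "is_gec H" and "absolutely_homogeneous H" and "is_gec G"
  shows "(\<exists>f. morphism f G H) \<longleftrightarrow>
    (\<forall>F. sub_gec F G \<and> finite (verts F) \<and> verts F \<noteq> {} \<longrightarrow> (\<exists>f. morphism f F H))"
proof
  assume "\<exists>f. morphism f G H"
  then obtain f where f: "partial_morphism (verts G) f G H"
    unfolding morphism_def by blast
  show "\<forall>F. sub_gec F G \<and> finite (verts F) \<and> verts F \<noteq> {} \<longrightarrow> (\<exists>f. morphism f F H)"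
  proof (intro allI impI)
    fix F
    assume "sub_gec F G \<and> finite (verts F) \<and> verts F \<noteq> {}"
    then obtain A where "A \<subseteq> verts G" "F = \<lparr>verts = A, col = restrict (col G) (A \<times> A)\<rparr>"
      unfolding sub_gec_def by blast
    then show "\<exists>f. morphism f F H"
      using partial_morphism_subset[OF f] morphism_restrict_iff by metis
  qed
next
  assume local: "\<forall>F. sub_gec F G \<and> finite (verts F) \<and> verts F \<noteq> {} \<longrightarrow> (\<exists>f. morphism f F H)"
  have "\<exists>f. partial_morphism A f G H" if "A \<subseteq> verts G" "finite A" for A
  proof (cases "A = {}")
    case True
    then show ?thesis
      by (simp add: partial_morphism_def)
  next
    case False
    then have "\<exists>f. morphism f \<lparr>verts = A, col = restrict (col G) (A \<times> A)\<rparr> H"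
      using local sub_gec_restrict[OF assms(3) that(1)] that(2) by simp
    then show ?thesis
      using morphism_restrict_iff[OF that(1)] by blast
  qed
  then show "\<exists>f. morphism f G H"
    unfolding morphism_def
    using partial_morphism_from_finite[OF assms(3,1,2) _ subset_refl] by blast
qed

end
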